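(* Let $G$ be a finite simple connected graph and let $x\in V(G)$. Let $G+y$ be the graph obtained from $G$ by adding a new vertex $y$ which is a copy of $x$. If $G$ is upper-critical, then $G+y$ is also upper-critical.
   Context: $N(x)$ is the set of vertices adjacent to $x$. A vertex $y$ is a copy of $x$ if $N(y)=N(x)$; thus $G+y$ has vertex set $V(G)\cup\{y\}$ with $y\notin V(G)$, all edges of $G$, and $y$ is joined exactly to the vertices of $N(x)$ (in particular $y$ is not adjacent to $x$). $\chi(G)$ is the chromatic number. $\overline{G}$ is the complement of $G$, and for $e\in E(\overline{G})$, $G+e$ is $G$ with the edge $e$ added. A finite simple graph $G$ is upper-critical if no edge can be added to it while preserving its chromatic number, i.e. $\{e\in E(\overline{G}) : \chi(G+e)=\chi(G)\}=\emptyset$ (equivalently, $\chi(G+e)>\chi(G)$ for all $e\in E(\overline{G})$; in particular every complete graph is upper-critical). This definition is applied to $G+y$ whether or not it is connected. *)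

theory Defs
  imports "Graph_Theory.Graph_Theory"
begin

text \<open>
  Finite simple graphs are the finite loop-free symmetric digraphs of the locale
  \<^locale>\<open>pair_graph\<close>: an undirected edge \<open>uv\<close> is represented by the two arcs \<open>(u, v)\<close> and
  \<open>(v, u)\<close>.
\<close>

definition neighbourhood :: "'a pair_pre_digraph \<Rightarrow> 'a \<Rightarrow> 'a set" where
  "neighbourhood G x = {v. (x, v) \<in> parcs G}"

definition complement_graph :: "'a pair_pre_digraph \<Rightarrow> 'a pair_pre_digraph" where
  "complement_graph G = \<lparr> pverts = pverts G,
     parcs = {(u, v). u \<in> pverts G \<and> v \<in> pverts G \<and> u \<noteq> v \<and> (u, v) \<notin> parcs G} \<rparr>"

definition add_edge :: "'a pair_pre_digraph \<Rightarrow> 'a \<times> 'a \<Rightarrow> 'a pair_pre_digraph" where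
  "add_edge G e = \<lparr> pverts = pverts G, parcs = parcs G \<union> {(fst e, snd e), (snd e, fst e)} \<rparr>"

text \<open>Only meaningful for \<open>y \<notin> pverts G\<close>.\<close>
definition add_copy :: "'a pair_pre_digraph \<Rightarrow> 'a \<Rightarrow> 'a \<Rightarrow> 'a pair_pre_digraph" where
  "add_copy G x y = \<lparr> pverts = insert y (pverts G),
     parcs = parcs G \<union> {y} \<times> neighbourhood G x \<union> neighbourhood G x \<times> {y} \<rparr>"

definition proper_colouring :: "'a pair_pre_digraph \<Rightarrow> nat \<Rightarrow> ('a \<Rightarrow> nat) \<Rightarrow> bool" where
  "proper_colouring G k c \<longleftrightarrow>
     (\<forall>v\<in>pverts G. c v < k) \<and> (\<forall>u v. (u, v) \<in> parcs G \<longrightarrow> c u \<noteq> c v)"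

definition chromatic_number :: "'a pair_pre_digraph \<Rightarrow> nat" where
  "chromatic_number G = (LEAST k. \<exists>c. proper_colouring G k c)"

definition upper_critical :: "'a pair_pre_digraph \<Rightarrow> bool" where
  "upper_critical G \<longleftrightarrow>
     {e \<in> parcs (complement_graph G). chromatic_number (add_edge G e) = chromatic_number G} = {}"

text \<open>The operations above stay within finite simple graphs, and colourings exist.\<close>

lemma pair_graph_iff:
  "pair_graph G \<longleftrightarrow> finite (pverts G) \<and> parcs G \<subseteq> pverts G \<times> pverts G \<and>
     sym (parcs G) \<and> irrefl (parcs G)"
proof
  assume "pair_graph G"
  then interpret pair_graph G .
  show "finite (pverts G) \<and> parcs G \<subseteq> pverts G \<times> pverts G \<and> sym (parcs G) \<and> irrefl (parcs G)"
    using pair_finite_verts arcs_symmetric no_loops'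
    by (auto simp: sym_def irrefl_def dest: wellformed')
next
  assume *: "finite (pverts G) \<and> parcs G \<subseteq> pverts G \<times> pverts G \<and> sym (parcs G) \<and> irrefl (parcs G)"
  then have "finite (parcs G)"
    by (meson finite_SigmaI finite_subset)
  with * show "pair_graph G"
    by unfold_locales (auto simp: symmetric_def irrefl_def)
qed

lemma pair_graph_complement_graph:
  "pair_graph G \<Longrightarrow> pair_graph (complement_graph G)"
  by (auto simp: pair_graph_iff complement_graph_def sym_def irrefl_def)

lemma pair_graph_add_edge:
  "pair_graph G \<Longrightarrow> e \<in> parcs (complement_graph G) \<Longrightarrow> pair_graph (add_edge G e)"
  by (auto simp: pair_graph_iff complement_graph_def add_edge_def sym_def irrefl_def)

lemma pair_graph_add_copy:
  "pair_graph G \<Longrightarrow> y \<notin> pverts G \<Longrightarrow> pair_graph (add_copy G x y)"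
  by (auto simp: pair_graph_iff add_copy_def neighbourhood_def sym_def irrefl_def)

lemma neighbourhood_add_copy:
  assumes "pair_graph G" "x \<in> pverts G" "y \<notin> pverts G"
  shows "neighbourhood (add_copy G x y) y = neighbourhood (add_copy G x y) x"
    and "neighbourhood (add_copy G x y) y = neighbourhood G x"
  using assms by (auto simp: pair_graph_iff add_copy_def neighbourhood_def irrefl_def)

lemma ex_proper_colouring:
  assumes "pair_graph G"
  shows "\<exists>c. proper_colouring G (card (pverts G)) c"
proof -
  from assms have "finite (pverts G)"
    by (simp add: pair_graph_iff)
  then obtain c where "bij_betw c (pverts G) {0..<card (pverts G)}"
    using ex_bij_betw_finite_nat by blast
  then have "proper_colouring G (card (pverts G)) c"
    using assms unfolding proper_colouring_def pair_graph_iff bij_betw_def inj_on_def irrefl_def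
    by (smt (verit) SigmaD1 SigmaD2 atLeastLessThan_iff imageI subsetD)
  then show ?thesis
    by blast
qed

end

theory Submission
  imports Defs
begin

text \<open>
  The upper-critical graphs are exactly the complete multipartite graphs, and duplicating a vertex
  of a complete multipartite graph merely enlarges one of its parts.

  If \<open>G\<close> is upper-critical and \<open>c\<close> is an optimal colouring, then joining two nonadjacent vertices of
  different colours would leave \<open>c\<close> proper and hence preserve the chromatic number; so the colour
  classes of \<open>c\<close> are the parts of a complete multipartite structure
  (\<open>upper_critical_imp_complete_multipartite\<close>). Conversely, a complete multipartite graph is
  colourable with one colour per part, whereas an extra edge inside a part yields a clique with one
  vertex more than there are parts: both ends of the edge and a vertex of every other part
  (\<open>complete_multipartite_imp_upper_critical\<close>).
\<close>

text \<open>The parts are the nonempty fibres of \<open>c\<close> on the vertices.\<close>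

definition complete_multipartite :: "'a pair_pre_digraph \<Rightarrow> ('a \<Rightarrow> 'b) \<Rightarrow> bool" where
  "complete_multipartite G c \<longleftrightarrow>
     parcs G = {(u, v). u \<in> pverts G \<and> v \<in> pverts G \<and> c u \<noteq> c v}"

lemma chromatic_number_le:
  "proper_colouring G k c \<Longrightarrow> chromatic_number G \<le> k"
  unfolding chromatic_number_def by (rule Least_le) blast

lemma ex_optimal_colouring:
  assumes "pair_graph G"
  obtains c where "proper_colouring G (chromatic_number G) c"
  using LeastI_ex[of "\<lambda>k. \<exists>c. proper_colouring G k c"] ex_proper_colouring[OF assms]
  unfolding chromatic_number_def by blast

lemma proper_colouring_add_edge_iff:
  "proper_colouring (add_edge G (u, v)) k c \<longleftrightarrow> proper_colouring G k c \<and> c u \<noteq> c v"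
  by (auto simp: proper_colouring_def add_edge_def)

lemma chromatic_number_le_add_edge:
  assumes "pair_graph G" "e \<in> parcs (complement_graph G)"
  shows "chromatic_number G \<le> chromatic_number (add_edge G e)"
proof -
  obtain c where "proper_colouring (add_edge G e) (chromatic_number (add_edge G e)) c"
    using ex_optimal_colouring pair_graph_add_edge[OF assms] by blast
  then have "proper_colouring G (chromatic_number (add_edge G e)) c"
    by (cases e) (simp add: proper_colouring_add_edge_iff)
  then show ?thesis
    by (rule chromatic_number_le)
qed

text \<open>
  An optimal colouring remains proper after joining two vertices of different colours, so
  criticality leaves no such pair nonadjacent.
\<close>

lemma upper_critical_imp_complete_multipartite:
  assumes G: "pair_graph G" and crit: "upper_critical G"
    and c: "proper_colouring G (chromatic_number G) c"
  shows "complete_multipartite G c"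
proof -
  have "(u, v) \<in> parcs G" if uv: "u \<in> pverts G" "v \<in> pverts G" "c u \<noteq> c v" for u v
  proof (rule ccontr)
    assume "(u, v) \<notin> parcs G"
    with uv have e: "(u, v) \<in> parcs (complement_graph G)"
      by (auto simp: complement_graph_def)
    have "proper_colouring (add_edge G (u, v)) (chromatic_number G) c"
      using c uv by (simp add: proper_colouring_add_edge_iff)
    then have "chromatic_number (add_edge G (u, v)) = chromatic_number G"
      using chromatic_number_le chromatic_number_le_add_edge[OF G e] by (metis le_antisym)
    with e crit show False
      by (auto simp: upper_critical_def)
  qed
  moreover have "u \<in> pverts G \<and> v \<in> pverts G \<and> c u \<noteq> c v" if "(u, v) \<in> parcs G" for u v
    using that G c by (auto simp: pair_graph_iff proper_colouring_def)
  ultimately show ?thesis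
    unfolding complete_multipartite_def by blast
qed

lemma chromatic_number_complete_multipartite_le:
  assumes "finite (pverts G)" "complete_multipartite G c"
  shows "chromatic_number G \<le> card (c ` pverts G)"
proof -
  have "finite (c ` pverts G)"
    using assms by simp
  then obtain f where f: "bij_betw f (c ` pverts G) {0..<card (c ` pverts G)}"
    using ex_bij_betw_finite_nat by blast
  have "proper_colouring G (card (c ` pverts G)) (f \<circ> c)"
    using assms(2) bij_betw_apply[OF f] inj_on_contraD[OF bij_betw_imp_inj_on[OF f]]
    by (auto simp: proper_colouring_def complete_multipartite_def)
  then show ?thesis
    by (rule chromatic_number_le)
qed

lemma clique_card_le:
  assumes "proper_colouring G k d" "T \<subseteq> pverts G"
    and "\<And>a b. a \<in> T \<Longrightarrow> b \<in> T \<Longrightarrow> a \<noteq> b \<Longrightarrow> (a, b) \<in> parcs G"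
  shows "card T \<le> k"
proof -
  have "inj_on d T"
    using assms(1,3) unfolding proper_colouring_def by (intro inj_onI) blast
  moreover have "d ` T \<subseteq> {..<k}"
    using assms(1,2) by (auto simp: proper_colouring_def)
  ultimately show ?thesis
    using card_inj_on_le[of d T "{..<k}"] by simp
qed

text \<open>
  The chromatic number is at most the number of parts, while an edge added inside a part creates
  a clique larger than that.
\<close>

lemma complete_multipartite_imp_upper_critical:
  assumes G: "pair_graph G" and c: "complete_multipartite G c"
  shows "upper_critical G"
proof -
  have fin: "finite (pverts G)"
    using G by (simp add: pair_graph_iff)
  have "chromatic_number (add_edge G e) \<noteq> chromatic_number G"
    if e: "e \<in> parcs (complement_graph G)" for e
  proof -
    obtain u v where uv: "e = (u, v)" by (cases e)
    have u: "u \<in> pverts G" and v: "v \<in> pverts G" and "u \<noteq> v" and "c u = c v"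
      using e c by (auto simp: uv complement_graph_def complete_multipartite_def)
    \<comment> \<open>\<open>r\<close> selects a vertex of each part, namely \<open>u\<close> in the part that contains the new edge.\<close>
    define r where "r = (inv_into (pverts G) c)(c u := u)"
    have r: "r p \<in> pverts G" "c (r p) = p" if "p \<in> c ` pverts G" for p
      using that u by (auto simp: r_def inv_into_into f_inv_into_f)
    define T where "T = insert v (r ` c ` pverts G)"
    have "v \<notin> r ` c ` pverts G"
    proof
      assume "v \<in> r ` c ` pverts G"
      then have "v = r (c v)"
        using r(2) by fastforce
      with \<open>u \<noteq> v\<close> \<open>c u = c v\<close> show False
        by (simp add: r_def)
    qed
    moreover have "inj_on r (c ` pverts G)"
      by (rule inj_on_inverseI[of _ c]) (rule r(2))
    ultimately have card: "card T = Suc (card (c ` pverts G))"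
      using fin by (simp add: T_def card_image)
    have sub: "T \<subseteq> pverts (add_edge G e)"
      using r(1) v by (auto simp: T_def add_edge_def)
    have new: "(a, b) \<in> parcs (add_edge G e)" if "a \<in> T" "b \<in> T" "a \<noteq> b" for a b
    proof (cases "c a = c b")
      case False
      then show ?thesis
        using that sub c by (auto simp: add_edge_def complete_multipartite_def)
    next
      case True
      have reps: "a = r (c a) \<or> a = v" "b = r (c b) \<or> b = v"
        using that r(2) by (auto simp: T_def)
      have "r (c v) = u"
        using \<open>c u = c v\<close> by (simp add: r_def)
      with reps True \<open>a \<noteq> b\<close> have "a = u \<and> b = v \<or> a = v \<and> b = u"
        by metis
      then show ?thesis
        by (auto simp: add_edge_def uv)
    qed
    obtain d where "proper_colouring (add_edge G e) (chromatic_number (add_edge G e)) d"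
      using ex_optimal_colouring pair_graph_add_edge[OF G e] by blast
    then have "card T \<le> chromatic_number (add_edge G e)"
      using sub new by (rule clique_card_le)
    with card chromatic_number_complete_multipartite_le[OF fin c] show ?thesis
      by linarith
  qed
  then show ?thesis
    by (auto simp: upper_critical_def)
qed

text \<open>The copy joins the part of the original vertex.\<close>

lemma complete_multipartite_add_copy:
  assumes "complete_multipartite G c" "x \<in> pverts G" "y \<notin> pverts G"
  shows "complete_multipartite (add_copy G x y) (c(y := c x))"
proof -
  have arc: "(u, v) \<in> parcs G \<longleftrightarrow> u \<in> pverts G \<and> v \<in> pverts G \<and> c u \<noteq> c v" for u v
    using assms(1) unfolding complete_multipartite_def by blast
  have "(u, v) \<in> parcs (add_copy G x y) \<longleftrightarrow>
      u \<in> insert y (pverts G) \<and> v \<in> insert y (pverts G) \<and>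
      (c(y := c x)) u \<noteq> (c(y := c x)) v" for u v
    using assms(2,3)
    by (cases "u = y"; cases "v = y") (simp_all add: add_copy_def neighbourhood_def arc eq_commute)
  moreover have "pverts (add_copy G x y) = insert y (pverts G)"
    by (simp add: add_copy_def)
  ultimately show ?thesis
    unfolding complete_multipartite_def by blast
qed

theorem theorem5:
  fixes G :: "'a pair_pre_digraph" and x y :: 'a
  assumes "pair_graph G"
    and "connected (with_proj G)"
    and "x \<in> pverts G"
    and "y \<notin> pverts G"
    and "upper_critical G"
  shows "upper_critical (add_copy G x y)"
proof -
  obtain c where "proper_colouring G (chromatic_number G) c"
    using ex_optimal_colouring assms(1) by blast
  then have "complete_multipartite G c"
    using upper_critical_imp_complete_multipartite assms(1,5) by blast
  then have "complete_multipartite (add_copy G x y) (c(y := c x))"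
    using assms(3,4) by (rule complete_multipartite_add_copy)
  then show ?thesis
    using complete_multipartite_imp_upper_critical pair_graph_add_copy[OF assms(1,4)] by blast
qed

end
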